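(* Assume the subgraph $\mathcal G_{\sigma(t)}$ is undirected for all $t\ge0$, and that there exist $T_{\mathrm c}>0$ and a subsequence $\{t_{j_k}:k=0,1,2,\dots\}$ of the switching instants with $t_{j_0}=0$ and $t_{j_{k+1}}-t_{j_k}\le T_{\mathrm c}$, such that for every $k$ every node $i\in\{1,\dots,N\}$ is reachable from node $0$ in the union graph $\bigcup_{t_j\in[t_{j_k},t_{j_{k+1}})}\bar{\mathcal G}_{\sigma(t_j)}$. Then there exists $0<\delta<1$ such that for every positive integer $\ell$, $$\left\|\prod_{r=j_k}^{j_{k+\ell}-1}P_{\sigma(t_r)}\right\|\le\delta^{\ell}\quad\text{for all }k=0,1,2,\dots.$$
   Context: $\sigma:[0,\infty)\to\mathcal P=\{1,\dots,n_0\}$ is a piecewise constant switching signal: there are switching instants $0=t_0<t_1<\cdots$ and a dwell time $\tau>0$ with $t_{j+1}-t_j\ge\tau$, and $\sigma$ is constant on each $[t_j,t_{j+1})$. For each $p\in\mathcal P$, $\bar{\mathcal G}_p$ is a graph on nodes $\{0,1,\dots,N\}$ with edge set $\bar{\mathcal E}_p$ of ordered pairs $(j,i)$, $j\ne i$; $a_{ij}(t)=1$ if $(j,i)\in\bar{\mathcal E}_{\sigma(t)}$, else $0$. $\mathcal G_{\sigma(t)}$ is the subgraph on $\{1,\dots,N\}$ with the edges of $\bar{\mathcal E}_{\sigma(t)}$ among those nodes (undirected: $(i,j)$ edge iff $(j,i)$ edge), with Laplacian $\mathcal L_{\sigma(t)}$ ($l_{ii}=\sum_{j=1}^Na_{ij}(t)$,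 $l_{ij}=-a_{ij}(t)$, $i\ne j$). $\Delta_{\sigma(t)}=\mathrm{diag}(a_{10}(t),\dots,a_{N0}(t))$, $\mathcal H_{\sigma(t)}=\mathcal L_{\sigma(t)}+\Delta_{\sigma(t)}$, and $P_{\sigma(t)}$ is the orthogonal projection of $\mathbb{R}^N$ onto $\ker\mathcal H_{\sigma(t)}$ (zero matrix if the kernel is trivial). Node $i$ is reachable from $0$ if the graph has edges $(0,i_2),(i_2,i_3),\dots,(i_s,i)$; the union graph has the union of edge sets. $\prod_{r=m}^n\Xi_r=\Xi_n\cdots\Xi_m$. $\|\cdot\|$ is the matrix norm induced by the Euclidean norm. *)

theory Defs
  imports "HOL-Analysis.Analysis"
begin

text \<open>Nodes: the leader node 0 is None, followers 1..N are Some i with i :: 'n (CARD('n) = N).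
  An edge set is a relation on 'n option; (j,i) means the edge from j to i.\<close>

definition adj :: "('n option \<times> 'n option) set \<Rightarrow> 'n \<Rightarrow> 'n \<Rightarrow> real" where
  "adj E i j = (if (Some j, Some i) \<in> E then 1 else 0)"

definition lead_adj :: "('n option \<times> 'n option) set \<Rightarrow> 'n \<Rightarrow> real" where
  "lead_adj E i = (if (None, Some i) \<in> E then 1 else 0)"

definition laplacian :: "('n::finite option \<times> 'n option) set \<Rightarrow> real^'n^'n" where
  "laplacian E = (\<chi> i j. if i = j then (\<Sum>k\<in>UNIV. adj E i k) else - adj E i j)"

definition Delta_mat :: "('n::finite option \<times> 'n option) set \<Rightarrow> real^'n^'n" where
  "Delta_mat E = (\<chi> i j. if i = j then lead_adj E i else 0)"

definition H_mat :: "('n::finite option \<times> 'n option) set \<Rightarrow> real^'n^'n" where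
  "H_mat E = laplacian E + Delta_mat E"

text \<open>Orthogonal projection (as a matrix) onto the kernel of a matrix.\<close>
definition proj_ker :: "real^'n^'n \<Rightarrow> real^'n^'n" where
  "proj_ker H = (THE P. \<forall>x. H *v (P *v x) = 0 \<and>
       (\<forall>y. H *v y = 0 \<longrightarrow> (x - P *v x) \<bullet> y = 0))"

text \<open>Ordered product: lprod f m d = f (m+d-1) ** ... ** f m  (identity if d = 0).\<close>
fun lprod :: "(nat \<Rightarrow> real^'n^'n) \<Rightarrow> nat \<Rightarrow> nat \<Rightarrow> real^'n^'n" where
  "lprod f m 0 = mat 1"
| "lprod f m (Suc d) = f (m + d) ** lprod f m d"

end

theory Submission
  imports Defs
begin

text \<open>
  Each \<open>proj_ker H\<close> is an orthogonal projection, so it does not increase norms and preserves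
  the norm of \<open>x\<close> only if \<open>H x = 0\<close>. For an undirected loop-free graph,
  \<open>x \<bullet> H x = (\<Sum>i k. a\<^sub>i\<^sub>k (x\<^sub>i - x\<^sub>k)\<^sup>2) / 2 + (\<Sum>i. a\<^sub>i\<^sub>0 x\<^sub>i\<^sup>2)\<close>, so a kernel vector is constant
  along follower edges and vanishes at followers adjacent to the leader. If the product over
  one connectivity window preserved the norm of some \<open>x \<noteq> 0\<close>, then \<open>x\<close> would lie in every kernel
  of the window and hence vanish at every node reachable from the leader, i.e. everywhere.
  By compactness of the unit sphere each window product therefore has operator norm below 1.
  The dwell time bounds the length of a window by \<open>Tc / \<tau>\<close>, so only finitely many window
  products occur; \<open>\<delta>\<close> is the largest of their norms (or 1/2), and submultiplicativity of the
  operator norm gives \<open>\<delta>\<^sup>\<ell>\<close> for \<open>\<ell>\<close> consecutive windows.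
\<close>

lemma kernel_projection_unique:
  fixes H :: "real^'n^'m"
  assumes "H *v y = 0" "H *v y' = 0"
    and "\<And>w. H *v w = 0 \<Longrightarrow> (x - y) \<bullet> w = 0"
    and "\<And>w. H *v w = 0 \<Longrightarrow> (x - y') \<bullet> w = 0"
  shows "y = y'"
proof -
  have "H *v (y - y') = 0"
    using assms(1,2) by (simp add: matrix_vector_mult_diff_distrib)
  then have "(x - y') \<bullet> (y - y') - (x - y) \<bullet> (y - y') = 0"
    using assms(3,4) by simp
  then have "(y - y') \<bullet> (y - y') = 0"
    by (simp add: inner_diff_left)
  then show ?thesis by simp
qed

lemma ex_kernel_projection_matrix:
  fixes H :: "real^'n^'m"
  shows "\<exists>P::real^'n^'n. \<forall>x. H *v (P *v x) = 0 \<and> (\<forall>y. H *v y = 0 \<longrightarrow> (x - P *v x) \<bullet> y = 0)"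
proof -
  have "subspace {y. H *v y = 0}"
    by (rule linear_subspace_kernel) (simp add: matrix_vector_mul_linear)
  then obtain B where B_orth: "pairwise orthogonal B"
      and B_norm: "\<And>b. b \<in> B \<Longrightarrow> norm b = 1" and B_indep: "independent B"
      and B_span: "span B = {y. H *v y = 0}"
    by (rule orthonormal_basis_subspace) auto
  have B_fin: "finite B"
    using B_indep by (rule independent_imp_finite)
  define Q where "Q x = (\<Sum>b\<in>B. (x \<bullet> b) *\<^sub>R b)" for x
  have "linear Q"
    unfolding Q_def
    by (intro linear_compose_sum ballI) (simp add: linear_iff inner_add_left scaleR_add_left)
  then have matrix_Q: "matrix Q *v x = Q x" for x
    by simp
  have Q_ker: "H *v Q x = 0" for x
  proof -
    have "Q x \<in> span B"
      unfolding Q_def by (intro span_sum span_mul span_base)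
    then show ?thesis using B_span by simp
  qed
  have Q_basis: "Q x \<bullet> b = x \<bullet> b" if "b \<in> B" for x b
  proof -
    have "Q x \<bullet> b = (\<Sum>b'\<in>B. if b' = b then x \<bullet> b else 0)"
      unfolding Q_def inner_sum_left
      using B_orth B_norm[OF that] that
      by (intro sum.cong) (auto simp: pairwise_def orthogonal_def dot_square_norm)
    also have "\<dots> = x \<bullet> b"
      using B_fin that by simp
    finally show ?thesis .
  qed
  have "(x - Q x) \<bullet> y = 0" if "H *v y = 0" for x y
  proof -
    have "y \<in> span B" using that B_span by simp
    then have "orthogonal (x - Q x) y"
      by (rule orthogonal_to_span) (simp add: orthogonal_def inner_diff_left Q_basis)
    then show ?thesis by (simp add: orthogonal_def)
  qed
  then show ?thesis
    using Q_ker matrix_Q by (intro exI[of _ "matrix Q"]) simp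
qed

lemma
  fixes H :: "real^'n^'n"
  shows proj_ker_in_kernel: "H *v (proj_ker H *v x) = 0"
    and proj_ker_orthogonal: "H *v y = 0 \<Longrightarrow> (x - proj_ker H *v x) \<bullet> y = 0"
proof -
  let ?is_proj = "\<lambda>P. \<forall>x. H *v (P *v x) = 0 \<and> (\<forall>y. H *v y = 0 \<longrightarrow> (x - P *v x) \<bullet> y = 0)"
  have "\<exists>!P. ?is_proj P"
  proof (rule ex_ex1I)
    show "\<exists>P. ?is_proj P" by (rule ex_kernel_projection_matrix)
  next
    fix P P' assume "?is_proj P" "?is_proj P'"
    then show "P = P'"
      unfolding matrix_eq by (metis kernel_projection_unique)
  qed
  then have "?is_proj (proj_ker H)"
    unfolding proj_ker_def by (rule theI')
  then show "H *v (proj_ker H *v x) = 0" and "H *v y = 0 \<Longrightarrow> (x - proj_ker H *v x) \<bullet> y = 0"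
    by auto
qed

lemma norm_proj_ker_Pythagoras:
  "(norm (proj_ker H *v x))\<^sup>2 + (norm (x - proj_ker H *v x))\<^sup>2 = (norm x)\<^sup>2"
proof -
  have "(x - proj_ker H *v x) \<bullet> (proj_ker H *v x) = 0"
    by (intro proj_ker_orthogonal proj_ker_in_kernel)
  then show ?thesis
    using norm_add_Pythagorean[of "proj_ker H *v x" "x - proj_ker H *v x"]
    by (simp add: orthogonal_def inner_commute)
qed

lemma norm_proj_ker_le: "norm (proj_ker H *v x) \<le> norm x"
proof (rule power2_le_imp_le)
  show "(norm (proj_ker H *v x))\<^sup>2 \<le> (norm x)\<^sup>2"
    using norm_proj_ker_Pythagoras[of H x] zero_le_power2[of "norm (x - proj_ker H *v x)"]
    by linarith
qed simp

lemma proj_ker_fixes_iff_kernel: "proj_ker H *v x = x \<longleftrightarrow> H *v x = 0"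
proof
  assume "proj_ker H *v x = x"
  then show "H *v x = 0" using proj_ker_in_kernel[of H x] by simp
next
  assume "H *v x = 0"
  then have "(x - proj_ker H *v x) \<bullet> (x - proj_ker H *v x) = 0"
    by (simp add: inner_diff_right proj_ker_orthogonal proj_ker_in_kernel)
  then show "proj_ker H *v x = x" by simp
qed

lemma norm_proj_ker_eq_imp_fixes:
  assumes "norm (proj_ker H *v x) = norm x"
  shows "proj_ker H *v x = x"
  using norm_proj_ker_Pythagoras[of H x] assms by simp

lemma lprod_add: "lprod f m (a + b) = lprod f (m + a) b ** lprod f m a"
  by (induction b) (simp_all add: matrix_mul_assoc add.assoc)

lemma lprod_fixes:
  assumes "\<And>r. r \<in> {m..<m + d} \<Longrightarrow> f r *v x = x"
  shows "lprod f m d *v x = x"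
  using assms by (induction d) (simp_all flip: matrix_vector_mul_assoc)

lemma norm_lprod_proj_ker_le: "norm (lprod (\<lambda>r. proj_ker (H r)) m d *v x) \<le> norm x"
proof (induction d)
  case (Suc d)
  then show ?case
    using norm_proj_ker_le[of "H (m + d)" "lprod (\<lambda>r. proj_ker (H r)) m d *v x"]
    by (simp flip: matrix_vector_mul_assoc)
qed simp

lemma norm_lprod_proj_ker_eq_imp_kernel:
  assumes "norm (lprod (\<lambda>r. proj_ker (H r)) m d *v x) = norm x" and "r \<in> {m..<m + d}"
  shows "H r *v x = 0"
  using assms
proof (induction d arbitrary: r)
  case (Suc d)
  let ?y = "lprod (\<lambda>r. proj_ker (H r)) m d *v x"
  have "norm (proj_ker (H (m + d)) *v ?y) = norm x"
    using Suc.prems(1) by (simp flip: matrix_vector_mul_assoc)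
  then have y_norm: "norm ?y = norm x" and last_norm: "norm (proj_ker (H (m + d)) *v ?y) = norm ?y"
    using norm_proj_ker_le[of "H (m + d)" ?y] norm_lprod_proj_ker_le[of H m d x] by linarith+
  have kernel_before: "H r' *v x = 0" if "r' \<in> {m..<m + d}" for r'
    using Suc.IH[OF y_norm that] .
  then have "?y = x"
    by (intro lprod_fixes) (simp add: proj_ker_fixes_iff_kernel)
  then have "H (m + d) *v x = 0"
    using norm_proj_ker_eq_imp_fixes[OF last_norm] by (simp add: proj_ker_fixes_iff_kernel)
  then show ?case
    using kernel_before Suc.prems(2) by (cases "r = m + d") auto
qed simp

lemma onorm_less_1_if_norm_less:
  fixes f :: "'a::euclidean_space \<Rightarrow> 'b::real_normed_vector"
  assumes f: "bounded_linear f" and shrinks: "\<And>x. x \<noteq> 0 \<Longrightarrow> norm (f x) < norm x"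
  shows "onorm f < 1"
proof -
  have "continuous_on (sphere 0 1) (\<lambda>x. norm (f x))"
    by (intro continuous_on_norm linear_continuous_on f)
  then obtain x0 where x0: "x0 \<in> sphere 0 1"
      and x0_max: "\<And>y. y \<in> sphere 0 1 \<Longrightarrow> norm (f y) \<le> norm (f x0)"
    using continuous_attains_sup[of "sphere (0::'a) 1" "\<lambda>x. norm (f x)"] by auto
  have "onorm f \<le> norm (f x0)"
  proof (rule onorm_le)
    fix x :: 'a
    show "norm (f x) \<le> norm (f x0) * norm x"
    proof (cases "x = 0")
      case False
      then have "norm (f (x /\<^sub>R norm x)) \<le> norm (f x0)"
        by (intro x0_max) simp
      then show ?thesis
        using False by (simp add: linear_scale[OF bounded_linear.linear[OF f]] field_simps)
    qed (simp add: linear_0[OF bounded_linear.linear[OF f]])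
  qed
  also have "norm (f x0) < 1"
    using shrinks[of x0] x0 by fastforce
  finally show ?thesis .
qed

lemma H_mat_apply:
  assumes "(Some i, Some i) \<notin> E"
  shows "(H_mat E *v x) $ i = (\<Sum>k\<in>UNIV. adj E i k * (x$i - x$k)) + lead_adj E i * x$i"
proof -
  let ?d = "(\<Sum>k\<in>UNIV. adj E i k) + lead_adj E i"
  have entry: "H_mat E $ i $ j = (if j = i then ?d else 0) - adj E i j" for j
    using assms by (simp add: H_mat_def laplacian_def Delta_mat_def adj_def)
  have "(H_mat E *v x) $ i = (\<Sum>j\<in>UNIV. (if j = i then ?d * x$j else 0) - adj E i j * x$j)"
    unfolding matrix_vector_mult_def vec_lambda_beta by (intro sum.cong) (auto simp: entry left_diff_distrib)
  also have "\<dots> = ?d * x$i - (\<Sum>j\<in>UNIV. adj E i j * x$j)"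
    by (simp add: sum_subtractf)
  also have "\<dots> = (\<Sum>k\<in>UNIV. adj E i k * (x$i - x$k)) + lead_adj E i * x$i"
    by (simp add: right_diff_distrib sum_subtractf sum_distrib_left algebra_simps)
  finally show ?thesis .
qed

lemma H_mat_quadratic_form:
  assumes sym: "\<And>i k. (Some k, Some i) \<in> E \<longleftrightarrow> (Some i, Some k) \<in> E"
    and no_loop: "\<And>i. (Some i, Some i) \<notin> E"
  shows "x \<bullet> (H_mat E *v x) =
    (\<Sum>i\<in>UNIV. \<Sum>k\<in>UNIV. adj E i k * (x$i - x$k)\<^sup>2) / 2 + (\<Sum>i\<in>UNIV. lead_adj E i * (x$i)\<^sup>2)"
proof -
  define A where "A = (\<Sum>i\<in>UNIV. \<Sum>k\<in>UNIV. adj E i k * x$i * (x$i - x$k))"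
  have adj_sym: "adj E i k = adj E k i" for i k
    using sym by (simp add: adj_def)
  have "x \<bullet> (H_mat E *v x) = A + (\<Sum>i\<in>UNIV. lead_adj E i * (x$i)\<^sup>2)"
    unfolding A_def inner_vec_def H_mat_apply[OF no_loop]
    by (simp add: sum_distrib_left sum.distrib power2_eq_square algebra_simps)
  moreover have "2 * A = (\<Sum>i\<in>UNIV. \<Sum>k\<in>UNIV. adj E i k * (x$i - x$k)\<^sup>2)"
  proof -
    have "A = (\<Sum>i\<in>UNIV. \<Sum>k\<in>UNIV. adj E i k * x$k * (x$k - x$i))"
      unfolding A_def by (subst sum.swap) (simp add: adj_sym)
    then have "2 * A = (\<Sum>i\<in>UNIV. \<Sum>k\<in>UNIV. adj E i k * x$i * (x$i - x$k) + adj E i k * x$k * (x$k - x$i))"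
      unfolding A_def by (simp add: sum.distrib)
    also have "\<dots> = (\<Sum>i\<in>UNIV. \<Sum>k\<in>UNIV. adj E i k * (x$i - x$k)\<^sup>2)"
      by (intro sum.cong refl) (simp add: power2_eq_square algebra_simps)
    finally show ?thesis .
  qed
  ultimately show ?thesis by simp
qed

lemma H_mat_kernel_edges:
  assumes sym: "\<And>i k. (Some k, Some i) \<in> E \<longleftrightarrow> (Some i, Some k) \<in> E"
    and no_loop: "\<And>i. (Some i, Some i) \<notin> E"
    and kernel: "H_mat E *v x = 0"
  shows H_mat_kernel_follower_edge: "(Some a, Some b) \<in> E \<Longrightarrow> x$a = x$b"
    and H_mat_kernel_leader_edge: "(None, Some b) \<in> E \<Longrightarrow> x$b = 0"
proof -
  have adj_nonneg: "0 \<le> adj E i k" and lead_nonneg: "0 \<le> lead_adj E i" for i k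
    by (simp_all add: adj_def lead_adj_def)
  let ?F = "\<Sum>i\<in>UNIV. \<Sum>k\<in>UNIV. adj E i k * (x$i - x$k)\<^sup>2"
  let ?L = "\<Sum>i\<in>UNIV. lead_adj E i * (x$i)\<^sup>2"
  have "?F / 2 + ?L = 0"
    using H_mat_quadratic_form[OF sym no_loop, of x] kernel by simp
  moreover have "0 \<le> ?F" and "0 \<le> ?L"
    by (intro sum_nonneg mult_nonneg_nonneg adj_nonneg lead_nonneg zero_le_power2)+
  ultimately have "?F = 0" and "?L = 0" by linarith+
  then have adj_term: "adj E i k * (x$i - x$k)\<^sup>2 = 0" and lead_term: "lead_adj E i * (x$i)\<^sup>2 = 0"
    for i k by (simp_all add: sum_nonneg_eq_0_iff adj_nonneg lead_nonneg sum_nonneg)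
  show "(Some a, Some b) \<in> E \<Longrightarrow> x$a = x$b"
    using adj_term[of b a] by (simp add: adj_def)
  show "(None, Some b) \<in> E \<Longrightarrow> x$b = 0"
    using lead_term[of b] by (simp add: lead_adj_def)
qed

lemma H_mat_kernel_vanishes_on_reachable:
  fixes E :: "'j \<Rightarrow> ('n::finite option \<times> 'n option) set"
  assumes sym: "\<And>j i k. j \<in> J \<Longrightarrow> (Some k, Some i) \<in> E j \<longleftrightarrow> (Some i, Some k) \<in> E j"
    and no_loop: "\<And>j i. j \<in> J \<Longrightarrow> (Some i, Some i) \<notin> E j"
    and kernel: "\<And>j. j \<in> J \<Longrightarrow> H_mat (E j) *v x = 0"
    and reach: "(None, Some i) \<in> (\<Union>j\<in>J. E j)\<^sup>+"
  shows "x $ i = 0"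
proof -
  have "x $ b = 0" if "(None, v) \<in> (\<Union>j\<in>J. E j)\<^sup>+" "v = Some b" for v b
    using that
  proof (induction arbitrary: b rule: trancl_induct)
    case (base v)
    then obtain j where "j \<in> J" "(None, Some b) \<in> E j" by blast
    then show ?case
      using H_mat_kernel_leader_edge[OF sym no_loop kernel] by blast
  next
    case (step u v)
    then obtain j where j: "j \<in> J" "(u, Some b) \<in> E j" by blast
    show ?case
    proof (cases u)
      case None
      then show ?thesis
        using H_mat_kernel_leader_edge[OF sym no_loop kernel, OF j(1) j(1) j(1)] j(2) by simp
    next
      case (Some a)
      then show ?thesis
        using H_mat_kernel_follower_edge[OF sym no_loop kernel, OF j(1) j(1) j(1)] j(2) step.IH
        by simp
    qed
  qed
  then show ?thesis using reach by blast
qed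

lemma onorm_lprod_proj_ker_less_1:
  fixes E :: "nat \<Rightarrow> ('n::finite option \<times> 'n option) set"
  assumes sym: "\<And>r i k. r \<in> {m..<m + d} \<Longrightarrow> (Some k, Some i) \<in> E r \<longleftrightarrow> (Some i, Some k) \<in> E r"
    and no_loop: "\<And>r i. r \<in> {m..<m + d} \<Longrightarrow> (Some i, Some i) \<notin> E r"
    and reach: "\<And>i. (None, Some i) \<in> (\<Union>r\<in>{m..<m + d}. E r)\<^sup>+"
  shows "onorm (\<lambda>x. lprod (\<lambda>r. proj_ker (H_mat (E r))) m d *v x) < 1"
proof (rule onorm_less_1_if_norm_less)
  fix x :: "real^'n"
  assume "x \<noteq> 0"
  show "norm (lprod (\<lambda>r. proj_ker (H_mat (E r))) m d *v x) < norm x"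
  proof (rule ccontr)
    assume "\<not> ?thesis"
    then have isometric: "norm (lprod (\<lambda>r. proj_ker (H_mat (E r))) m d *v x) = norm x"
      using norm_lprod_proj_ker_le[of "\<lambda>r. H_mat (E r)" m d x] by linarith
    have kernel: "H_mat (E r) *v x = 0" if "r \<in> {m..<m + d}" for r
      using norm_lprod_proj_ker_eq_imp_kernel[of "\<lambda>r. H_mat (E r)", OF isometric that] .
    have "x $ i = 0" for i
      using H_mat_kernel_vanishes_on_reachable[of "{m..<m + d}" E, OF sym no_loop kernel reach] .
    then show False
      using \<open>x \<noteq> 0\<close> by (simp add: vec_eq_iff)
  qed
qed (rule matrix_vector_mul_bounded_linear)

lemma finite_lprod_bounded_length:
  assumes "finite F"
  shows "finite {lprod f m d | f m d. range f \<subseteq> F \<and> d \<le> D}"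
proof (rule finite_subset)
  have "lprod f m d = foldr (**) (rev (map f [m..<m + d])) (mat 1)" for f m d
    by (induction d) simp_all
  then show "{lprod f m d | f m d. range f \<subseteq> F \<and> d \<le> D} \<subseteq>
      (\<lambda>xs. foldr (**) xs (mat 1)) ` {xs. set xs \<subseteq> F \<and> length xs \<le> D}"
    by fastforce
  show "finite ((\<lambda>xs. foldr (**) xs (mat 1)) ` {xs. set xs \<subseteq> F \<and> length xs \<le> D})"
    using assms by (intro finite_imageI finite_lists_length_le)
qed

lemma onorm_lprod_blocks_le:
  fixes f :: "nat \<Rightarrow> real^'n^'n"
  assumes "mono js" and "0 \<le> \<delta>"
    and block: "\<And>k. onorm (\<lambda>x. lprod f (js k) (js (Suc k) - js k) *v x) \<le> \<delta>"
  shows "onorm (\<lambda>x. lprod f (js k) (js (k + l) - js k) *v x) \<le> \<delta> ^ l"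
proof (induction l)
  case (Suc l)
  let ?A = "lprod f (js k) (js (k + l) - js k)"
    and ?B = "lprod f (js (k + l)) (js (Suc (k + l)) - js (k + l))"
  have "js k \<le> js (k + l)" "js (k + l) \<le> js (Suc (k + l))"
    using \<open>mono js\<close> by (simp_all add: monoD)
  then have "lprod f (js k) (js (k + Suc l) - js k) = ?B ** ?A"
    using lprod_add[of f "js k" "js (k + l) - js k" "js (Suc (k + l)) - js (k + l)"] by simp
  then have "onorm (\<lambda>x. lprod f (js k) (js (k + Suc l) - js k) *v x) =
      onorm ((\<lambda>x. ?B *v x) \<circ> (\<lambda>x. ?A *v x))"
    by (simp add: o_def matrix_vector_mul_assoc)
  also have "\<dots> \<le> onorm (\<lambda>x. ?B *v x) * onorm (\<lambda>x. ?A *v x)"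
    by (intro onorm_compose matrix_vector_mul_bounded_linear)
  also have "\<dots> \<le> \<delta> * \<delta> ^ l"
    using Suc.IH block[of "k + l"] \<open>0 \<le> \<delta>\<close>
    by (intro mult_mono onorm_pos_le matrix_vector_mul_bounded_linear) simp_all
  finally show ?case by simp
qed (simp add: onorm_id)

lemma ex_uniform_bound_less_1:
  fixes g :: "'a \<Rightarrow> real"
  assumes "finite (range g)" and "\<And>k. g k < 1"
  shows "\<exists>\<delta>. 0 < \<delta> \<and> \<delta> < 1 \<and> (\<forall>k. g k \<le> \<delta>)"
proof -
  have "Max (range g) < 1"
    using assms by (subst Max_less_iff) auto
  then show ?thesis
    using assms(1) by (intro exI[of _ "max (1/2) (Max (range g))"]) (auto intro: max.coboundedI2)
qed

lemma dwell_time_index_gap_le: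
  fixes t :: "nat \<Rightarrow> real"
  assumes dwell: "\<And>j. \<tau> \<le> t (Suc j) - t j" and "0 < \<tau>"
    and "a \<le> b" and "t b - t a \<le> T"
  shows "b - a \<le> nat \<lceil>T / \<tau>\<rceil>"
proof -
  have "real (b - a) * \<tau> \<le> t b - t a"
    using \<open>a \<le> b\<close>
  proof (induction b rule: dec_induct)
    case (step b)
    then show ?case using dwell[of b] by (simp add: Suc_diff_le algebra_simps)
  qed simp
  then have "real (b - a) \<le> T / \<tau>"
    using assms(2,4) by (simp add: pos_le_divide_eq)
  then show ?thesis by linarith
qed

theorem corollary1:
  fixes n0 :: nat
    and \<sigma> :: "real \<Rightarrow> nat"
    and t :: "nat \<Rightarrow> real"
    and \<tau> :: real
    and E :: "nat \<Rightarrow> ('n::finite option \<times> 'n option) set"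
    and js :: "nat \<Rightarrow> nat"
    and Tc :: real
  assumes t0: "t 0 = 0"
    and tau_pos: "\<tau> > 0"
    and dwell: "\<And>j. t (Suc j) - t j \<ge> \<tau>"
    and sigma_range: "\<And>s. s \<ge> 0 \<Longrightarrow> \<sigma> s \<in> {1..n0}"
    and sigma_const: "\<And>j s. t j \<le> s \<Longrightarrow> s < t (Suc j) \<Longrightarrow> \<sigma> s = \<sigma> (t j)"
    and no_loops: "\<And>p v. p \<in> {1..n0} \<Longrightarrow> (v, v) \<notin> E p"
    and undirected: "\<And>s i j. s \<ge> 0 \<Longrightarrow>
        ((Some j, Some i) \<in> E (\<sigma> s) \<longleftrightarrow> (Some i, Some j) \<in> E (\<sigma> s))"
    and Tc_pos: "Tc > 0"
    and subseq: "strict_mono js"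
    and js0: "t (js 0) = 0"
    and Tc_bound: "\<And>k. t (js (Suc k)) - t (js k) \<le> Tc"
    and reach: "\<And>k i. (None, Some i) \<in>
        (\<Union>j\<in>{j. t (js k) \<le> t j \<and> t j < t (js (Suc k))}. E (\<sigma> (t j)))\<^sup>+"
  shows "\<exists>\<delta>::real. 0 < \<delta> \<and> \<delta> < 1 \<and>
    (\<forall>l::nat. l \<ge> 1 \<longrightarrow> (\<forall>k.
       onorm (\<lambda>x. lprod (\<lambda>r. proj_ker (H_mat (E (\<sigma> (t r))))) (js k) (js (k + l) - js k) *v x)
         \<le> \<delta> ^ l))"
proof -
  have "t j < t (Suc j)" for j
    using dwell[of j] tau_pos by linarith
  then have t_mono: "strict_mono t"
    by (simp add: strict_mono_Suc_iff)
  then have t_nonneg: "0 \<le> t r" for r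
    using t0 by (metis le0 strict_mono_less_eq)
  have mode: "\<sigma> (t r) \<in> {1..n0}" for r
    using sigma_range t_nonneg by blast
  define M where
    "M k = lprod (\<lambda>r. proj_ker (H_mat (E (\<sigma> (t r))))) (js k) (js (Suc k) - js k)" for k
  have js_le: "js k \<le> js (Suc k)" for k
    using subseq by (simp add: strict_mono_less_eq)
  have block: "{j. t (js k) \<le> t j \<and> t j < t (js (Suc k))} = {js k..<js k + (js (Suc k) - js k)}"
    for k
    using t_mono js_le[of k] by (auto simp: strict_mono_less_eq strict_mono_less)
  have M_contracts: "onorm (\<lambda>x. M k *v x) < 1" for k
    unfolding M_def
    by (rule onorm_lprod_proj_ker_less_1)
      (use undirected t_nonneg no_loops mode reach block in auto)
  have block_length: "js (Suc k) - js k \<le> nat \<lceil>Tc / \<tau>\<rceil>" for k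
    using dwell_time_index_gap_le[of \<tau> t, OF dwell tau_pos js_le Tc_bound] .
  have "range M \<subseteq> {lprod f m d | f m d.
      range f \<subseteq> (\<lambda>p. proj_ker (H_mat (E p))) ` {1..n0} \<and> d \<le> nat \<lceil>Tc / \<tau>\<rceil>}"
    unfolding M_def using mode block_length by blast
  then have "finite (range M)"
    by (rule finite_subset) (intro finite_lprod_bounded_length finite_imageI finite_atLeastAtMost)
  then have "finite (range (\<lambda>k. onorm (\<lambda>x. M k *v x)))"
    using finite_imageI[of "range M" "\<lambda>A. onorm (\<lambda>x. A *v x)"] by (simp add: image_image)
  then obtain \<delta> where \<delta>: "0 < \<delta>" "\<delta> < 1" and M_le: "\<And>k. onorm (\<lambda>x. M k *v x) \<le> \<delta>"
    using ex_uniform_bound_less_1 M_contracts by blast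
  show ?thesis
    using onorm_lprod_blocks_le[OF strict_mono_mono[OF subseq] _ M_le[unfolded M_def]] \<delta>
    by auto
qed

end
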